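(* Let $(M,a)$ and $(M',a')$ be pointed metric spaces. The map $d:\mathbb{L}\mathrm{L}((M,a),(M',a'))^2\to\mathbb R_+$ (defined in the context) factors through the quotient by the relation of tangency at $a$, and gives a distance (i.e. a metric) on the set $\mathbb{J}\mathrm{et}((M,a),(M',a'))$, defined by $d(q(f),q(g))=d(f,g)$ for all $f,g\in\mathbb{L}\mathrm{L}((M,a),(M',a'))$.
   Context: For metric spaces $M,M'$ and $a\in M$, two maps $f,g:M\to M'$ are tangent at $a$ if $\forall\varepsilon>0\ \exists\eta>0\ \forall x\in M\ (d(x,a)\le\eta\Rightarrow d(f(x),g(x))\le\varepsilon\, d(x,a))$; this is an equivalence relation. A map $f:M\to M'$ is locally Lipschitz at $a$ if there exist a neighborhood $V$ of $a$ and $k>0$ such that $f|_V$ is $k$-Lipschitz. $\mathbb{L}\mathrm{L}((M,a),(M',a'))$ is the set of maps $f:M\to M'$ which are locally Lipschitz at $a$ and satisfy $f(a)=a'$. $\mathbb{J}\mathrm{et}((M,a),(M',a'))$ is its quotient by the relation of tangency at $a$, with canonical surjection $q$. For $f,g\in\mathbb{L}\mathrm{L}((M,a),(M',a'))$ put $C(a)=0$ and $C(x)=d(f(x),g(x))/d(x,a)$ for $x\ne a$; $C$ is bounded on some neighborhood $V$ of $a$. For $r>0$ let $d^r(f,g)=\sup\{C(x)\mid x\in B'(a,r)\cap V\}$ where $B'(a,r)$ is the closed ball (for small $r$ this does not depend on $V$), and $d(f,g)=\lim_{r\to0}d^r(f,g)=\inf_{r>0}d^r(f,g)$. *)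

theory Defs
  imports "HOL-Analysis.Analysis"
begin

definition tangent_at ::
  "'a::metric_space \<Rightarrow> ('a \<Rightarrow> 'b::metric_space) \<Rightarrow> ('a \<Rightarrow> 'b) \<Rightarrow> bool" where
  "tangent_at a f g \<longleftrightarrow>
    (\<forall>\<epsilon>>0. \<exists>\<eta>>0. \<forall>x. dist x a \<le> \<eta> \<longrightarrow> dist (f x) (g x) \<le> \<epsilon> * dist x a)"

definition locally_lipschitz_at ::
  "'a::metric_space \<Rightarrow> ('a \<Rightarrow> 'b::metric_space) \<Rightarrow> bool" where
  "locally_lipschitz_at a f \<longleftrightarrow> (\<exists>V k. a \<in> interior V \<and> k > 0 \<and> k-lipschitz_on V f)"

definition LL :: "'a::metric_space \<Rightarrow> 'b::metric_space \<Rightarrow> ('a \<Rightarrow> 'b) set" where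
  "LL a a' = {f. locally_lipschitz_at a f \<and> f a = a'}"

definition tangency :: "'a::metric_space \<Rightarrow> 'b::metric_space \<Rightarrow> (('a \<Rightarrow> 'b) \<times> ('a \<Rightarrow> 'b)) set" where
  "tangency a a' = {(f, g). f \<in> LL a a' \<and> g \<in> LL a a' \<and> tangent_at a f g}"

definition Jet :: "'a::metric_space \<Rightarrow> 'b::metric_space \<Rightarrow> ('a \<Rightarrow> 'b) set set" where
  "Jet a a' = LL a a' // tangency a a'"

definition jet_of :: "'a::metric_space \<Rightarrow> 'b::metric_space \<Rightarrow> ('a \<Rightarrow> 'b) \<Rightarrow> ('a \<Rightarrow> 'b) set" where
  "jet_of a a' f = tangency a a' `` {f}"

definition slope_at ::
  "'a::metric_space \<Rightarrow> ('a \<Rightarrow> 'b::metric_space) \<Rightarrow> ('a \<Rightarrow> 'b) \<Rightarrow> 'a \<Rightarrow> real" where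
  "slope_at a f g x = (if x = a then 0 else dist (f x) (g x) / dist x a)"

definition slope_bounded_nhd ::
  "'a::metric_space \<Rightarrow> ('a \<Rightarrow> 'b::metric_space) \<Rightarrow> ('a \<Rightarrow> 'b) \<Rightarrow> 'a set \<Rightarrow> bool" where
  "slope_bounded_nhd a f g V \<longleftrightarrow> a \<in> interior V \<and> bdd_above (slope_at a f g ` V)"

definition LL_dist_r ::
  "'a::metric_space \<Rightarrow> 'a set \<Rightarrow> real \<Rightarrow> ('a \<Rightarrow> 'b::metric_space) \<Rightarrow> ('a \<Rightarrow> 'b) \<Rightarrow> real" where
  "LL_dist_r a V r f g = (SUP x\<in>cball a r \<inter> V. slope_at a f g x)"

text \<open>The choice of the neighbourhood does not matter: see \<open>LL_dist_r_nhd_irrelevant\<close>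
  and \<open>LL_dist_eq\<close>. For maps in \<open>LL a a'\<close> a suitable neighbourhood exists and
  the limit does too, by \<open>LL_slope_bounded_nhd\<close> and \<open>LL_dist_r_tendsto\<close>.\<close>

definition LL_dist ::
  "'a::metric_space \<Rightarrow> ('a \<Rightarrow> 'b::metric_space) \<Rightarrow> ('a \<Rightarrow> 'b) \<Rightarrow> real" where
  "LL_dist a f g =
    Lim (at_right 0) (\<lambda>r. LL_dist_r a (SOME V. slope_bounded_nhd a f g V) r f g)"

lemma LL_slope_bounded_nhd:
  assumes "f \<in> LL a a'" "g \<in> LL a a'"
  shows "\<exists>V. slope_bounded_nhd a f g V"
proof -
  obtain V k where V: "a \<in> interior V" "k-lipschitz_on V f"
    using assms(1) unfolding LL_def locally_lipschitz_at_def by auto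
  obtain W l where W: "a \<in> interior W" "l-lipschitz_on W g"
    using assms(2) unfolding LL_def locally_lipschitz_at_def by auto
  have kl: "0 \<le> k + l"
    using lipschitz_on_nonneg[OF V(2)] lipschitz_on_nonneg[OF W(2)] by simp
  have "slope_at a f g x \<le> k + l" if x: "x \<in> V \<inter> W" for x
  proof (cases "x = a")
    case True
    then show ?thesis using kl by (simp add: slope_at_def)
  next
    case False
    have aV: "a \<in> V" "a \<in> W" using V(1) W(1) interior_subset by auto
    have "dist (f x) (g x) \<le> dist (f x) (f a) + dist (g x) (g a)"
      using assms dist_triangle2[of "f x" "g x" a'] by (simp add: LL_def)
    also have "\<dots> \<le> k * dist x a + l * dist x a"
      using lipschitz_onD[OF V(2), of x a] lipschitz_onD[OF W(2), of x a] x aV by auto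
    finally show ?thesis
      using False by (simp add: slope_at_def divide_le_eq distrib_right)
  qed
  then have "bdd_above (slope_at a f g ` (V \<inter> W))" by (auto intro!: bdd_aboveI)
  then show ?thesis
    using V(1) W(1) unfolding slope_bounded_nhd_def by (intro exI[of _ "V \<inter> W"]) simp
qed

lemma LL_dist_r_nhd_irrelevant:
  assumes "a \<in> interior V" "a \<in> interior W"
  shows "\<forall>\<^sub>F r in at_right 0. LL_dist_r a V r f g = LL_dist_r a W r f g"
proof -
  have "a \<in> interior (V \<inter> W)" using assms by simp
  then obtain e where e: "e > 0" "cball a e \<subseteq> V \<inter> W"
    by (meson mem_interior_cball)
  have "LL_dist_r a V r f g = LL_dist_r a W r f g" if "0 < r" "r < e" for r
  proof -
    have "cball a r \<subseteq> V \<inter> W" using that e(2) by (auto simp: subset_iff)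
    then have "cball a r \<inter> V = cball a r \<inter> W" by auto
    then show ?thesis by (simp add: LL_dist_r_def)
  qed
  then show ?thesis
    using e(1) by (auto simp: eventually_at_right_field)
qed

lemma LL_dist_r_tendsto:
  assumes "slope_bounded_nhd a f g V"
  shows "((\<lambda>r. LL_dist_r a V r f g) \<longlongrightarrow> (INF r\<in>{0<..}. LL_dist_r a V r f g)) (at_right 0)"
proof -
  let ?h = "\<lambda>r. LL_dist_r a V r f g"
  have aV: "a \<in> V" using assms interior_subset unfolding slope_bounded_nhd_def by auto
  have bd: "bdd_above (slope_at a f g ` (cball a r \<inter> V))" for r
    using assms unfolding slope_bounded_nhd_def by (meson bdd_above_mono image_mono inf_le2)
  have mono: "?h r \<le> ?h s" if "0 < r" "r \<le> s" for r s
  proof -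
    have "cball a r \<inter> V \<noteq> {}" using that aV by (auto simp: disjoint_iff intro!: exI[of _ a])
    then show ?thesis
      unfolding LL_dist_r_def using that by (intro cSUP_subset_mono bd \<open>cball a r \<inter> V \<noteq> {}\<close>) (auto simp: subset_iff)
  qed
  have nonneg: "0 \<le> ?h r" if "0 < r" for r
  proof -
    have "slope_at a f g a \<le> ?h r"
      unfolding LL_dist_r_def using that aV by (intro cSUP_upper bd) auto
    then show ?thesis by (simp add: slope_at_def)
  qed
  have bb: "bdd_below (?h ` {0<..})" using nonneg by (auto intro!: bdd_belowI)
  show ?thesis
  proof (rule order_tendstoI)
    fix y assume y: "y < (INF r\<in>{0<..}. ?h r)"
    have "y < ?h r" if "0 < r" for r
      using cINF_lower[OF bb, of r] y that by simp
    then show "\<forall>\<^sub>F r in at_right 0. y < ?h r"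
      by (auto simp: eventually_at_right_field intro: exI[of _ 1])
  next
    fix y assume y: "(INF r\<in>{0<..}. ?h r) < y"
    then obtain s where s: "0 < s" "?h s < y"
      using cINF_less_iff[OF _ bb, of y] by (auto simp: greaterThan_non_empty)
    then show "\<forall>\<^sub>F r in at_right 0. ?h r < y"
      using mono by (auto simp: eventually_at_right_field intro!: exI[of _ s] le_less_trans[OF _ s(2)])
  qed
qed

lemma LL_dist_eq:
  assumes "slope_bounded_nhd a f g V"
  shows "((\<lambda>r. LL_dist_r a V r f g) \<longlongrightarrow> LL_dist a f g) (at_right 0)"
    and "LL_dist a f g = (INF r\<in>{0<..}. LL_dist_r a V r f g)"
proof -
  let ?W = "SOME V. slope_bounded_nhd a f g V"
  have W: "slope_bounded_nhd a f g ?W" using assms by (rule someI)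
  have "((\<lambda>r. LL_dist_r a ?W r f g) \<longlongrightarrow> (INF r\<in>{0<..}. LL_dist_r a V r f g)) (at_right 0)"
    using assms W
    by (intro Lim_transform_eventually[OF LL_dist_r_tendsto[OF assms]] LL_dist_r_nhd_irrelevant)
      (auto simp: slope_bounded_nhd_def)
  then show *: "LL_dist a f g = (INF r\<in>{0<..}. LL_dist_r a V r f g)"
    unfolding LL_dist_def by (intro tendsto_Lim) auto
  show "((\<lambda>r. LL_dist_r a V r f g) \<longlongrightarrow> LL_dist a f g) (at_right 0)"
    unfolding * by (rule LL_dist_r_tendsto[OF assms])
qed

lemma equiv_tangency: "equiv (LL a a') (tangency a a')"
proof (rule equivI)
  show "tangency a a' \<subseteq> LL a a' \<times> LL a a'" by (auto simp: tangency_def)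
  show "refl_on (LL a a') (tangency a a')"
    by (auto simp: refl_on_def tangency_def tangent_at_def intro: exI[of _ 1])
  show "sym (tangency a a')"
    by (auto simp: sym_def tangency_def tangent_at_def dist_commute)
  show "trans (tangency a a')"
  proof (rule transI)
    fix f g h assume fg: "(f, g) \<in> tangency a a'" and gh: "(g, h) \<in> tangency a a'"
    have "tangent_at a f h"
      unfolding tangent_at_def
    proof (intro allI impI)
      fix e :: real assume "e > 0"
      then have e: "e / 2 > 0" by simp
      obtain n where n: "n > 0" "\<And>x. dist x a \<le> n \<Longrightarrow> dist (f x) (g x) \<le> e / 2 * dist x a"
        using fg e unfolding tangency_def tangent_at_def by blast
      obtain m where m: "m > 0" "\<And>x. dist x a \<le> m \<Longrightarrow> dist (g x) (h x) \<le> e / 2 * dist x a"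
        using gh e unfolding tangency_def tangent_at_def by blast
      have "dist (f x) (h x) \<le> e * dist x a" if "dist x a \<le> min n m" for x
        using n(2)[of x] m(2)[of x] dist_triangle[of "f x" "h x" "g x"] that by simp
      then show "\<exists>\<eta>>0. \<forall>x. dist x a \<le> \<eta> \<longrightarrow> dist (f x) (h x) \<le> e * dist x a"
        using n(1) m(1) by (intro exI[of _ "min n m"]) auto
    qed
    then show "(f, h) \<in> tangency a a'" using fg gh by (auto simp: tangency_def)
  qed
qed

end

theory Submission
  imports Defs
begin

text \<open>The number \<open>d(f, g)\<close> is the infimum of all \<open>c \<ge> 0\<close> with \<open>d(f x, g x) \<le> c d(x, a)\<close> near \<open>a\<close>.
  Read this way, \<open>d(f, g) = 0\<close> is tangency and the triangle inequality is inherited from \<open>M'\<close>;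
  so \<open>d\<close> is a pseudometric whose zero relation is tangency, and it passes to the quotient.\<close>

text \<open>Since \<open>LL_dist_r\<close> tends to \<open>LL_dist a f g\<close>, it is below
  \<open>c\<close> for all small radii, and a supremum below \<open>c\<close> bounds every slope in
  its ball. The strict inequality supplies the room, as the limit may be approached only from
  above.\<close>

lemma LL_dist_less_imp_bound:
  assumes f: "f \<in> LL a a'" and g: "g \<in> LL a a'" and less: "LL_dist a f g < c"
  shows "\<exists>\<eta>>0. \<forall>x. dist x a \<le> \<eta> \<longrightarrow> dist (f x) (g x) \<le> c * dist x a"
proof -
  obtain V where V: "slope_bounded_nhd a f g V"
    using LL_slope_bounded_nhd[OF f g] by blast
  have "\<forall>\<^sub>F r in at_right 0. LL_dist_r a V r f g < c"
    using order_tendstoD(2)[OF LL_dist_eq(1)[OF V] less] .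
  then obtain s where s: "s > 0" "\<And>r. 0 < r \<Longrightarrow> r < s \<Longrightarrow> LL_dist_r a V r f g < c"
    by (auto simp: eventually_at_right_field)
  obtain e where e: "e > 0" "cball a e \<subseteq> V"
    using V unfolding slope_bounded_nhd_def by (meson mem_interior_cball)
  \<comment> \<open>The closed \<open>\<eta>\<close>-ball must lie in \<open>V\<close>, and
    \<open>\<eta>\<close> itself must be a radius strictly below \<open>s\<close>.\<close>
  define \<eta> where "\<eta> = min e (s / 2)"
  have \<eta>: "0 < \<eta>" "\<eta> \<le> e" "\<eta> < s"
    using s(1) e(1) by (auto simp: \<eta>_def min_def)
  have "dist (f x) (g x) \<le> c * dist x a" if x: "dist x a \<le> \<eta>" for x
  proof (cases "x = a")
    case True
    then show ?thesis using f g by (simp add: LL_def)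
  next
    case False
    have xV: "x \<in> cball a \<eta> \<inter> V"
      using x \<eta>(2) e(2) by (auto simp: dist_commute)
    have "bdd_above (slope_at a f g ` (cball a \<eta> \<inter> V))"
      using V unfolding slope_bounded_nhd_def by (meson bdd_above_mono image_mono inf_le2)
    then have "slope_at a f g x \<le> LL_dist_r a V \<eta> f g"
      unfolding LL_dist_r_def using xV by (intro cSUP_upper)
    also have "\<dots> < c" using s(2) \<eta> by blast
    finally show ?thesis using False by (simp add: slope_at_def divide_less_eq)
  qed
  then show ?thesis using \<eta>(1) by blast
qed

text \<open>The closed \<open>\<eta>\<close>-ball serves as the neighbourhood for computing
  \<open>LL_dist\<close>: all slopes there are at most \<open>c\<close>, hence so are the suprema
  and their limit. At \<open>a\<close> this uses \<open>0 \<le> c\<close>, the slope being 0 by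
  convention.\<close>

lemma bound_imp_LL_dist_le:
  assumes c: "0 \<le> c" and \<eta>: "\<eta> > 0"
    and bound: "\<And>x. dist x a \<le> \<eta> \<Longrightarrow> dist (f x) (g x) \<le> c * dist x a"
  shows "LL_dist a f g \<le> c"
proof -
  have le: "slope_at a f g x \<le> c" if "x \<in> cball a \<eta>" for x
    using bound[of x] that c by (auto simp: slope_at_def dist_commute divide_le_eq)
  then have V: "slope_bounded_nhd a f g (cball a \<eta>)"
    unfolding slope_bounded_nhd_def mem_interior_cball using \<eta> by (auto intro!: bdd_aboveI)
  show ?thesis
  proof (rule tendsto_upperbound[OF LL_dist_eq(1)[OF V]])
    have "LL_dist_r a (cball a \<eta>) r f g \<le> c" if "0 < r" for r
      unfolding LL_dist_r_def
    proof (rule cSUP_least)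
      show "cball a r \<inter> cball a \<eta> \<noteq> {}"
        using that \<eta> by (auto simp: disjoint_iff intro!: exI[of _ a])
    qed (use le in auto)
    then show "\<forall>\<^sub>F r in at_right 0. LL_dist_r a (cball a \<eta>) r f g \<le> c"
      by (auto simp: eventually_at_right_field intro: exI[of _ 1])
  qed simp
qed

lemma LL_dist_nonneg:
  assumes "f \<in> LL a a'" "g \<in> LL a a'"
  shows "0 \<le> LL_dist a f g"
proof -
  obtain V where V: "slope_bounded_nhd a f g V"
    using LL_slope_bounded_nhd[OF assms] by blast
  then have aV: "a \<in> V" and bd: "bdd_above (slope_at a f g ` V)"
    using interior_subset unfolding slope_bounded_nhd_def by auto
  have "0 \<le> LL_dist_r a V r f g" if "0 < r" for r
  proof -
    have "bdd_above (slope_at a f g ` (cball a r \<inter> V))"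
      using bd by (meson bdd_above_mono image_mono inf_le2)
    \<comment> \<open>The conventional slope 0 at \<open>a\<close> enters every supremum, even when
      \<open>a\<close> is isolated.\<close>
    then have "slope_at a f g a \<le> LL_dist_r a V r f g"
      unfolding LL_dist_r_def using that aV by (intro cSUP_upper) auto
    then show ?thesis by (simp add: slope_at_def)
  qed
  then show ?thesis
    unfolding LL_dist_eq(2)[OF V] by (intro cINF_greatest) auto
qed

lemma LL_dist_commute: "LL_dist a f g = LL_dist a g f"
proof -
  \<comment> \<open>Equality as functions makes the predicates under \<open>SOME\<close> coincide,
    so both sides use the same neighbourhood.\<close>
  have "slope_at a f g = slope_at a g f"
    by (auto simp: slope_at_def dist_commute)
  then show ?thesis
    by (simp add: LL_dist_def LL_dist_r_def slope_bounded_nhd_def)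
qed

text \<open>Tangency asks for the linear bound with every \<open>\<epsilon> > 0\<close>; the two
  bound lemmas turn this into \<open>LL_dist a f g \<le> \<epsilon>\<close> for every such
  \<open>\<epsilon>\<close>.\<close>

lemma LL_dist_eq_0_iff:
  assumes "f \<in> LL a a'" "g \<in> LL a a'"
  shows "LL_dist a f g = 0 \<longleftrightarrow> tangent_at a f g"
proof
  assume "LL_dist a f g = 0"
  then show "tangent_at a f g"
    using LL_dist_less_imp_bound[OF assms] by (simp add: tangent_at_def)
next
  assume t: "tangent_at a f g"
  have "LL_dist a f g \<le> 0"
  proof (rule field_le_epsilon)
    fix e :: real assume "e > 0"
    then obtain \<eta> where "\<eta> > 0" "\<And>x. dist x a \<le> \<eta> \<Longrightarrow> dist (f x) (g x) \<le> e * dist x a"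
      using t unfolding tangent_at_def by blast
    then show "LL_dist a f g \<le> 0 + e"
      using \<open>e > 0\<close> by (simp add: bound_imp_LL_dist_le)
  qed
  then show "LL_dist a f g = 0"
    using LL_dist_nonneg[OF assms] by simp
qed

lemma LL_dist_triangle:
  assumes f: "f \<in> LL a a'" and g: "g \<in> LL a a'" and h: "h \<in> LL a a'"
  shows "LL_dist a f h \<le> LL_dist a f g + LL_dist a g h"
proof (rule field_le_epsilon)
  fix e :: real assume e: "e > 0"
  \<comment> \<open>Linear bounds are available only for constants strictly above the distance, so
    each term is raised by half of \<open>e\<close>; the bounds then add up through
    \<open>g x\<close>.\<close>
  define c where "c = LL_dist a f g + e / 2"
  define d where "d = LL_dist a g h + e / 2"
  obtain n where n: "n > 0" "\<And>x. dist x a \<le> n \<Longrightarrow> dist (f x) (g x) \<le> c * dist x a"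
    using LL_dist_less_imp_bound[OF f g, of c] e by (auto simp: c_def)
  obtain m where m: "m > 0" "\<And>x. dist x a \<le> m \<Longrightarrow> dist (g x) (h x) \<le> d * dist x a"
    using LL_dist_less_imp_bound[OF g h, of d] e by (auto simp: d_def)
  have "LL_dist a f h \<le> c + d"
  proof (rule bound_imp_LL_dist_le)
    show "0 \<le> c + d"
      using LL_dist_nonneg[OF f g] LL_dist_nonneg[OF g h] e by (simp add: c_def d_def)
    show "0 < min n m" using n(1) m(1) by simp
    show "dist (f x) (h x) \<le> (c + d) * dist x a" if "dist x a \<le> min n m" for x
      using n(2)[of x] m(2)[of x] dist_triangle[of "f x" "h x" "g x"] that
      by (simp add: distrib_right)
  qed
  then show "LL_dist a f h \<le> LL_dist a f g + LL_dist a g h + e"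
    by (simp add: c_def d_def)
qed

lemma tangency_iff_LL_dist:
  "(f, g) \<in> tangency a a' \<longleftrightarrow> f \<in> LL a a' \<and> g \<in> LL a a' \<and> LL_dist a f g = 0"
  using LL_dist_eq_0_iff by (auto simp: tangency_def)

text \<open>The triangle inequality, applied in both directions, with
  \<open>LL_dist a f f' = 0\<close>.\<close>

lemma LL_dist_respects_left:
  assumes "(f, f') \<in> tangency a a'" "g \<in> LL a a'"
  shows "LL_dist a f g = LL_dist a f' g"
  using assms LL_dist_triangle[of f a a' f' g] LL_dist_triangle[of f' a a' f g]
  by (simp add: tangency_iff_LL_dist LL_dist_commute[of a f' f])

lemma LL_dist_respects2: "LL_dist a respects2 (tangency a a')"
  by (rule congruent2_commuteI[OF equiv_tangency])
    (rule LL_dist_commute, metis LL_dist_commute LL_dist_respects_left)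

theorem proposition1p2p7:
  fixes a :: "'a::metric_space" and a' :: "'b::metric_space"
  shows "(LL_dist a :: ('a \<Rightarrow> 'b) \<Rightarrow> ('a \<Rightarrow> 'b) \<Rightarrow> real) respects2 (tangency a a') \<and>
    (\<exists>D. (\<forall>f\<in>LL a a'. \<forall>g\<in>LL a a'. D (jet_of a a' f) (jet_of a a' g) = LL_dist a f g) \<and>
         Metric_space (Jet a a') D)"
proof (intro conjI)
  show resp: "(LL_dist a :: ('a \<Rightarrow> 'b) \<Rightarrow> ('a \<Rightarrow> 'b) \<Rightarrow> real) respects2 (tangency a a')"
    by (rule LL_dist_respects2)
  let ?J = "Jet a a' :: ('a \<Rightarrow> 'b) set set"
  \<comment> \<open>\<open>Metric_space\<close> demands nonnegativity and symmetry outside the carrier as well.\<close>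
  define D :: "('a \<Rightarrow> 'b) set \<Rightarrow> ('a \<Rightarrow> 'b) set \<Rightarrow> real" where
    "D A B = (if A \<in> ?J \<and> B \<in> ?J then the_elem (\<Union>f\<in>A. \<Union>g\<in>B. {LL_dist a f g}) else 0)" for A B
  have jet: "jet_of a a' f \<in> ?J" if "f \<in> LL a a'" for f
    using that by (auto simp: Jet_def jet_of_def intro: quotientI)
  have D: "D (jet_of a a' f) (jet_of a a' g) = LL_dist a f g"
    if "f \<in> LL a a'" "g \<in> LL a a'" for f g
  proof -
    \<comment> \<open>\<open>UN_equiv_class2\<close> evaluates unions of set-valued maps over
      classes. With singleton values the union in \<open>D\<close> collapses to one singleton, which
      \<open>the_elem\<close> opens.\<close>
    have "(\<lambda>f g. {LL_dist a f g}) respects2 (tangency a a' :: (('a \<Rightarrow> 'b) \<times> _) set)"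
      using resp by (auto simp: congruent2_def)
    from UN_equiv_class2[OF equiv_tangency equiv_tangency this that] show ?thesis
      using jet that by (simp add: D_def jet_of_def)
  qed
  have surj: "\<exists>f\<in>LL a a'. A = jet_of a a' f" if "A \<in> ?J" for A
    using that by (auto simp: Jet_def jet_of_def elim: quotientE)
  have eq: "jet_of a a' f = jet_of a a' g \<longleftrightarrow> LL_dist a f g = 0"
    if "f \<in> LL a a'" "g \<in> LL a a'" for f g :: "'a \<Rightarrow> 'b"
    using eq_equiv_class_iff[OF equiv_tangency that] that
    by (simp add: jet_of_def tangency_iff_LL_dist)
  \<comment> \<open>On the carrier, choosing representatives by \<open>surj\<close> reduces each
    axiom to the matching fact on \<open>LL_dist\<close>; separation comes from
    \<open>eq\<close>.\<close>
  have "Metric_space ?J D"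
  proof
    fix A B
    show "0 \<le> D A B"
    proof (cases "A \<in> ?J \<and> B \<in> ?J")
      case True
      then show ?thesis using surj[of A] surj[of B] D LL_dist_nonneg by auto
    qed (auto simp: D_def)
    show "D A B = D B A"
    proof (cases "A \<in> ?J \<and> B \<in> ?J")
      case True
      then show ?thesis using surj[of A] surj[of B] D LL_dist_commute by auto
    qed (auto simp: D_def)
  next
    fix A B assume "A \<in> ?J" "B \<in> ?J"
    then show "D A B = 0 \<longleftrightarrow> A = B" using surj D eq by metis
  next
    fix A B C assume "A \<in> ?J" "B \<in> ?J" "C \<in> ?J"
    then show "D A C \<le> D A B + D B C"
      using surj[of A] surj[of B] surj[of C] D LL_dist_triangle by auto
  qed
  then show "\<exists>D. (\<forall>f\<in>LL a a'. \<forall>g\<in>LL a a'. D (jet_of a a' f) (jet_of a a' g) = LL_dist a f g) \<and>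
      Metric_space ?J D"
    using D by blast
qed

end
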